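(* The presentations $$\mathcal B_1=\langle x,y\mid [x,y],\ 1\rangle$$ and $$\mathcal B_2=\langle x,y\mid [x,[x,y^{-1}]]^2\,y[y^{-1},x]y^{-1},\ [x,[[y^{-1},x],x]]\rangle$$ are $Q^{**}$-equivalent.
   Context: Here $[a,b]=aba^{-1}b^{-1}$. Two finite group presentations are $Q^{**}$-equivalent if one can be transformed into the other by a finite sequence of the following operations on $\langle x_1,\dots,x_n\mid r_1,\dots,r_m\rangle$: (1) replace some $r_i$ by $r_i^{-1}$; (2) replace some $r_i$ by $r_ir_j$ with $j\neq i$; (3) replace some $r_i$ by $wr_iw^{-1}$ with $w$ in the free group $F(x_1,\dots,x_n)$; (4) add a generator $x_{n+1}$ and a relator $r_{m+1}=x_{n+1}$, or the inverse of this operation; (5) replace every $r_i$ by $\phi(r_i)$ for an automorphism $\phi$ of $F(x_1,\dots,x_n)$. (Adding or removing a trivial relator $1$ is not allowed.) *)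

theory Defs
  imports "HOL-Algebra.Group"
begin

text \<open>
  The free group of rank \<open>n\<close> is realised on the reduced words in the letters
  \<open>(i, e)\<close> with \<open>i < n\<close>; \<open>(i, True)\<close> stands for the generator \<open>x\<^sub>i\<^sub>+\<^sub>1\<close> and \<open>(i, False)\<close> for
  its inverse.  With this model, \<open>F(x\<^sub>1,\<dots>,x\<^sub>n)\<close> is literally a subset of
  \<open>F(x\<^sub>1,\<dots>,x\<^sub>n,x\<^sub>n\<^sub>+\<^sub>1)\<close>.
\<close>

type_synonym letter = "nat \<times> bool"

definition flip :: "letter \<Rightarrow> letter" where
  "flip a = (fst a, \<not> snd a)"

definition reduced :: "letter list \<Rightarrow> bool" where
  "reduced = successively (\<lambda>a b. b \<noteq> flip a)"

fun rcons :: "letter \<Rightarrow> letter list \<Rightarrow> letter list" where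
  "rcons a [] = [a]"
| "rcons a (b # w) = (if b = flip a then w else a # b # w)"

definition normal_form :: "letter list \<Rightarrow> letter list" where
  "normal_form w = foldr rcons w []"

definition free_group :: "nat \<Rightarrow> letter list monoid" where
  "free_group n =
     \<lparr>carrier = {w. reduced w \<and> fst ` set w \<subseteq> {..<n}},
      mult = (\<lambda>u v. normal_form (u @ v)),
      one = []\<rparr>"

definition gen :: "nat \<Rightarrow> letter list" where
  "gen i = [(i, True)]"

lemma flip_flip [simp]: "flip (flip a) = a"
  by (simp add: flip_def)

lemma fst_flip [simp]: "fst (flip a) = fst a"
  by (simp add: flip_def)

lemma flip_eq_iff: "a = flip b \<longleftrightarrow> b = flip a"
  by (auto simp: flip_def prod_eq_iff)

lemma reduced_Nil [simp]: "reduced []"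
  by (simp add: reduced_def)

lemma reduced_Cons: "reduced (a # w) \<longleftrightarrow> reduced w \<and> (w = [] \<or> hd w \<noteq> flip a)"
  by (auto simp: reduced_def successively_Cons)

lemma reduced_rcons: "reduced w \<Longrightarrow> reduced (rcons a w)"
  by (cases w) (auto simp: reduced_Cons)

lemma set_rcons: "set (rcons a w) \<subseteq> insert a (set w)"
  by (cases w) auto

lemma reduced_foldr_rcons: "reduced w \<Longrightarrow> reduced (foldr rcons u w)"
  by (induction u) (auto simp: reduced_rcons)

lemma set_foldr_rcons: "set (foldr rcons u w) \<subseteq> set u \<union> set w"
proof (induction u)
  case (Cons a u)
  then show ?case using set_rcons[of a "foldr rcons u w"] by auto
qed auto

lemma rcons_rcons_flip: "reduced w \<Longrightarrow> rcons a (rcons (flip a) w) = w"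
proof (cases w)
  case (Cons b w')
  assume "reduced w"
  then show ?thesis using Cons by (cases w') (auto simp: reduced_Cons)
qed simp

lemma rcons_reduced: "reduced (a # w) \<Longrightarrow> rcons a w = a # w"
  by (cases w) (auto simp: reduced_Cons)

lemma normal_form_reduced: "reduced w \<Longrightarrow> normal_form w = w"
  unfolding normal_form_def
  by (induction w) (auto simp: reduced_Cons rcons_reduced)

lemma foldr_rcons_rcons:
  assumes "reduced w"
  shows "foldr rcons (rcons a t) w = rcons a (foldr rcons t w)"
proof (cases t)
  case (Cons b t')
  then show ?thesis
    using rcons_rcons_flip[OF reduced_foldr_rcons[OF assms]] by auto
qed simp

lemma foldr_rcons_foldr_rcons:
  "reduced w \<Longrightarrow> foldr rcons (foldr rcons u v) w = foldr rcons u (foldr rcons v w)"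
  by (induction u) (auto simp: foldr_rcons_rcons)

lemma normal_form_append:
  "reduced v \<Longrightarrow> normal_form (u @ v) = foldr rcons u v"
  using normal_form_reduced[of v] by (simp add: normal_form_def)

lemma foldr_rcons_inverse:
  "reduced w \<Longrightarrow> foldr rcons (rev (map flip u)) (foldr rcons u w) = w"
proof (induction u arbitrary: w)
  case (Cons a u)
  then show ?case
    using rcons_rcons_flip[OF reduced_foldr_rcons[of w u], of "flip a"] by simp
qed simp

lemma reduced_inverse: "reduced u \<Longrightarrow> reduced (rev (map flip u))"
  unfolding reduced_def successively_rev successively_map
  by (erule successively_mono) (metis flip_flip)

lemma group_free_group: "group (free_group n)"
proof (rule groupI)
  fix u v w
  assume u: "u \<in> carrier (free_group n)" and v: "v \<in> carrier (free_group n)"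
  show "u \<otimes>\<^bsub>free_group n\<^esub> v \<in> carrier (free_group n)"
    using u v set_foldr_rcons[of u v]
    by (fastforce simp: free_group_def normal_form_append reduced_foldr_rcons)
  assume w: "w \<in> carrier (free_group n)"
  show "u \<otimes>\<^bsub>free_group n\<^esub> v \<otimes>\<^bsub>free_group n\<^esub> w = u \<otimes>\<^bsub>free_group n\<^esub> (v \<otimes>\<^bsub>free_group n\<^esub> w)"
    using u v w
    by (simp add: free_group_def normal_form_append reduced_foldr_rcons foldr_rcons_foldr_rcons)
next
  fix u assume u: "u \<in> carrier (free_group n)"
  show "\<one>\<^bsub>free_group n\<^esub> \<otimes>\<^bsub>free_group n\<^esub> u = u"
    using u by (simp add: free_group_def normal_form_reduced)
  have "rev (map flip u) \<in> carrier (free_group n)"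
    using u by (auto simp: free_group_def reduced_inverse)
  moreover have "rev (map flip u) \<otimes>\<^bsub>free_group n\<^esub> u = \<one>\<^bsub>free_group n\<^esub>"
    using u foldr_rcons_inverse[of "[]" u] normal_form_reduced[of u]
    by (simp add: free_group_def normal_form_def)
  ultimately show "\<exists>v\<in>carrier (free_group n). v \<otimes>\<^bsub>free_group n\<^esub> u = \<one>\<^bsub>free_group n\<^esub>"
    by blast
qed (simp add: free_group_def)

definition commutator :: "('a, 'b) monoid_scheme \<Rightarrow> 'a \<Rightarrow> 'a \<Rightarrow> 'a" where
  "commutator G a b = a \<otimes>\<^bsub>G\<^esub> b \<otimes>\<^bsub>G\<^esub> inv\<^bsub>G\<^esub> a \<otimes>\<^bsub>G\<^esub> inv\<^bsub>G\<^esub> b"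

text \<open>
  A finite presentation \<open>\<langle>x\<^sub>1,\<dots>,x\<^sub>n | r\<^sub>1,\<dots>,r\<^sub>m\<rangle>\<close> is the pair of \<open>n\<close> and the list of its relators;
  since \<open>x\<^sub>1\<close> is \<open>gen 0\<close>, the generator \<open>x\<^sub>n\<^sub>+\<^sub>1\<close> added by a stabilization is \<open>gen n\<close>.
  \<open>Qss\<close> abbreviates \<open>Q**\<close>.  Only stabilization needs an explicit inverse move: the inverses of
  the other moves are compositions of moves of the same kinds.
\<close>

type_synonym presentation = "nat \<times> letter list list"

definition is_presentation :: "presentation \<Rightarrow> bool" where
  "is_presentation P \<longleftrightarrow> set (snd P) \<subseteq> carrier (free_group (fst P))"

inductive Qss_step :: "presentation \<Rightarrow> presentation \<Rightarrow> bool" where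
  invert: "i < length rs \<Longrightarrow>
    Qss_step (n, rs) (n, rs[i := inv\<^bsub>free_group n\<^esub> (rs ! i)])"
| multiply: "i < length rs \<Longrightarrow> j < length rs \<Longrightarrow> j \<noteq> i \<Longrightarrow>
    Qss_step (n, rs) (n, rs[i := rs ! i \<otimes>\<^bsub>free_group n\<^esub> rs ! j])"
| conjugate: "i < length rs \<Longrightarrow> w \<in> carrier (free_group n) \<Longrightarrow>
    Qss_step (n, rs)
      (n, rs[i := w \<otimes>\<^bsub>free_group n\<^esub> rs ! i \<otimes>\<^bsub>free_group n\<^esub> inv\<^bsub>free_group n\<^esub> w])"
| stabilize: "Qss_step (n, rs) (Suc n, rs @ [gen n])"
| destabilize: "is_presentation (n, rs) \<Longrightarrow> Qss_step (Suc n, rs @ [gen n]) (n, rs)"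
| automorphism: "\<phi> \<in> iso (free_group n) (free_group n) \<Longrightarrow>
    Qss_step (n, rs) (n, map \<phi> rs)"

definition Qss_equivalent :: "presentation \<Rightarrow> presentation \<Rightarrow> bool" where
  "Qss_equivalent P P' \<longleftrightarrow>
     is_presentation P \<and> is_presentation P' \<and> Qss_step\<^sup>*\<^sup>* P P'"

lemma carrier_free_group_mono: "carrier (free_group n) \<subseteq> carrier (free_group (Suc n))"
  by (auto simp: free_group_def subset_iff less_Suc_eq)

lemma gen_in_carrier: "i < n \<Longrightarrow> gen i \<in> carrier (free_group n)"
  by (simp add: free_group_def gen_def reduced_Cons)

lemma is_presentation_Qss_step:
  assumes "Qss_step P P'" and "is_presentation P"
  shows "is_presentation P'"
  using assms
proof cases
  case (invert i rs n)
  interpret group "free_group n" by (rule group_free_group)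
  have "rs ! i \<in> carrier (free_group n)"
    using invert assms(2) by (auto simp: is_presentation_def)
  then show ?thesis
    using invert assms(2) by (simp add: is_presentation_def set_update_subsetI)
next
  case (multiply i rs j n)
  interpret group "free_group n" by (rule group_free_group)
  have "rs ! i \<in> carrier (free_group n)" "rs ! j \<in> carrier (free_group n)"
    using multiply assms(2) by (auto simp: is_presentation_def)
  then show ?thesis
    using multiply assms(2) by (simp add: is_presentation_def set_update_subsetI)
next
  case (conjugate i rs w n)
  interpret group "free_group n" by (rule group_free_group)
  have "rs ! i \<in> carrier (free_group n)"
    using conjugate assms(2) by (auto simp: is_presentation_def)
  then show ?thesis
    using conjugate assms(2) by (simp add: is_presentation_def set_update_subsetI)
next
  case (stabilize n rs)
  then show ?thesis
    using assms(2) carrier_free_group_mono[of n] gen_in_carrier[of n "Suc n"]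
    by (auto simp: is_presentation_def)
next
  case (automorphism \<phi> n rs)
  then show ?thesis
    using assms(2) by (auto simp: is_presentation_def iso_def hom_def)
qed auto

end

theory Submission
  imports Defs "HOL-Algebra.Coset"
begin

text \<open>
  Write \<open>\<rho> = [x,y]\<close>, \<open>e = [x,[x,y\<inverse>]]\<close>, and \<open>r\<^sub>1, r\<^sub>2\<close> for the relators of the second
  presentation; free cancellation gives \<open>r\<^sub>1 = e\<^sup>2\<rho>\<close>, and \<open>r\<^sub>2\<close> is a conjugate of \<open>[x,e]\<close>.
  A relator may be replaced by anything congruent to it modulo the normal closure of the other
  relators (\<open>replace_relator\<close>), so almost every step amounts to an implication between equations
  in an arbitrary group.

  The idea is to free \<open>e\<close> from its definition: stabilize by a generator \<open>t\<close> with relator \<open>t\<close> and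
  put \<open>d = te\<close>.  Modulo \<open>t\<close> the elements \<open>d\<close> and \<open>e\<close> agree, so \<open>r\<^sub>1\<close> and \<open>r\<^sub>2\<close> may be traded for
  \<open>d\<^sup>2\<rho>\<close> and \<open>[x,d]\<close>.  The point is that these two alone already force \<open>e = 1\<close> in every group
  (\<open>double_commutator_trivial\<close>); next to them the relators \<open>t\<close> and \<open>d\<close> are therefore
  interchangeable, and once \<open>d\<close> is a relator, \<open>d\<^sup>2\<rho>\<close> and \<open>[x,d]\<close> collapse to \<open>\<rho>\<close> and \<open>1\<close>.
  Read from the first presentation to the second, this is the chain of relator triples

  \<open>(\<rho>, 1, t) \<rightarrow> (\<rho>, 1, d) \<rightarrow> (\<rho>, [x,d], d) \<rightarrow> (d\<^sup>2\<rho>, [x,d], d) \<rightarrow> (d\<^sup>2\<rho>, [x,d], t)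
    \<rightarrow> (d\<^sup>2\<rho>, [x,e], t) \<rightarrow> (d\<^sup>2\<rho>, r\<^sub>2, t) \<rightarrow> (r\<^sub>1, r\<^sub>2, t)\<close>

  between a stabilization and a destabilization.  The first arrow holds because \<open>e\<close> lies in the
  normal closure of \<open>\<rho>\<close>.
\<close>

section \<open>Replacing a relator modulo the others\<close>

lemma (in group) inv_cancel_left [simp]:
  assumes "a \<in> carrier G" "b \<in> carrier G"
  shows "a \<otimes> (inv a \<otimes> b) = b" "inv a \<otimes> (a \<otimes> b) = b"
  using assms by (simp_all add: m_assoc[symmetric])

text \<open>
  The elements by which the \<open>i\<close>-th relator, whatever its current value, can be multiplied on the
  right form a normal subgroup containing the other relators.  Multiplying by \<open>m\<close> and then
  conjugating by \<open>m\<close>, all between two inversions, multiplies the relator by \<open>m\<inverse>\<close>; multiplying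
  by \<open>m\<close> between two mutually inverse conjugations multiplies it by a conjugate of \<open>m\<close>.
  Quantifying over all homomorphisms that kill the other relators expresses congruence modulo
  their normal closure; the target type is that of the quotients of the free group.
\<close>

lemma replace_relator:
  fixes n :: nat and F (structure)
  defines "F \<equiv> free_group n"
  assumes P: "is_presentation (n, rs)" and i: "i < length rs" and u: "u \<in> carrier F"
    and cong: "\<And>(K :: letter list set monoid) h. group K \<Longrightarrow> h \<in> hom F K \<Longrightarrow>
      (\<And>j. j < length rs \<Longrightarrow> j \<noteq> i \<Longrightarrow> h (rs ! j) = \<one>\<^bsub>K\<^esub>) \<Longrightarrow> h (rs ! i) = h u"
  shows "Qss_step\<^sup>*\<^sup>* (n, rs) (n, rs[i := u])"
proof -
  interpret group F unfolding F_def by (rule group_free_group)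
  define reach where "reach a b \<longleftrightarrow> Qss_step\<^sup>*\<^sup>* (n, rs[i := a]) (n, rs[i := b])" for a b
  have trans [trans]: "reach a c" if "reach a b" "reach b c" for a b c
    using that unfolding reach_def by (rule rtranclp_trans)
  have inv: "reach a (inv a)" for a
    using invert[of i "rs[i := a]" n] i by (auto simp: reach_def F_def)
  have conj: "reach a (w \<otimes> a \<otimes> inv w)" if "w \<in> carrier F" for a w
    using conjugate[of i "rs[i := a]" w n] i that by (auto simp: reach_def F_def)
  have mult: "reach a (a \<otimes> rs ! j)" if "j < length rs" "j \<noteq> i" for a j
    using multiply[of i "rs[i := a]" j n] i that by (auto simp: reach_def F_def)
  have rs: "rs ! j \<in> carrier F" if "j < length rs" for j
    using P that by (auto simp: is_presentation_def F_def)
  define M where "M = {m \<in> carrier F. \<forall>a \<in> carrier F. reach a (a \<otimes> m)}"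
  have "subgroup M F"
  proof (rule subgroupI)
    show "M \<noteq> {}"
      by (auto simp: M_def reach_def intro!: exI[of _ \<one>])
  next
    fix m assume m: "m \<in> M"
    have "reach a (a \<otimes> inv m)" if a: "a \<in> carrier F" for a
    proof -
      have mc: "m \<in> carrier F"
        using m by (simp add: M_def)
      have "reach a (inv a)"
        by (rule inv)
      also have "reach (inv a) (inv a \<otimes> m)"
        using m a by (simp add: M_def)
      also have "reach (inv a \<otimes> m) (m \<otimes> (inv a \<otimes> m) \<otimes> inv m)"
        using mc by (rule conj)
      also have "m \<otimes> (inv a \<otimes> m) \<otimes> inv m = m \<otimes> inv a"
        using a mc by (simp add: m_assoc)
      also have "reach (m \<otimes> inv a) (inv (m \<otimes> inv a))"
        by (rule inv)
      also have "inv (m \<otimes> inv a) = a \<otimes> inv m"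
        using a mc by (simp add: inv_mult_group)
      finally show ?thesis .
    qed
    then show "inv m \<in> M" using m by (simp add: M_def)
  next
    fix m m' assume "m \<in> M" "m' \<in> M"
    then show "m \<otimes> m' \<in> M"
      by (auto simp: M_def m_assoc[symmetric] intro: trans)
  qed (auto simp: M_def)
  moreover have "w \<otimes> m \<otimes> inv w \<in> M" if w: "w \<in> carrier F" and m: "m \<in> M" for w m
  proof -
    have "reach a (a \<otimes> (w \<otimes> m \<otimes> inv w))" if a: "a \<in> carrier F" for a
    proof -
      have mc: "m \<in> carrier F"
        using m by (simp add: M_def)
      have "reach a (inv w \<otimes> a \<otimes> w)"
        using conj[of "inv w" a] w by simp
      also have "reach (inv w \<otimes> a \<otimes> w) (inv w \<otimes> a \<otimes> w \<otimes> m)"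
        using m a w by (simp add: M_def)
      also have "reach (inv w \<otimes> a \<otimes> w \<otimes> m) (w \<otimes> (inv w \<otimes> a \<otimes> w \<otimes> m) \<otimes> inv w)"
        using w by (rule conj)
      also have "w \<otimes> (inv w \<otimes> a \<otimes> w \<otimes> m) \<otimes> inv w = a \<otimes> (w \<otimes> m \<otimes> inv w)"
        using a w mc by (simp add: m_assoc)
      finally show ?thesis .
    qed
    then show ?thesis using w m by (simp add: M_def)
  qed
  ultimately have M: "M \<lhd> F"
    by (rule normal_invI)
  then have M_sub: "subgroup M F"
    by (rule normal_imp_subgroup)
  have "M #> rs ! i = M #> u"
  proof (rule cong[OF normal.factorgroup_is_group[OF M] normal.r_coset_hom_Mod[OF M]])
    fix j assume "j < length rs" "j \<noteq> i"
    then have "rs ! j \<in> M"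
      using rs mult by (simp add: M_def)
    then show "M #> rs ! j = \<one>\<^bsub>F Mod M\<^esub>"
      using coset_join2[OF rs M_sub] \<open>j < length rs\<close> by (simp add: FactGroup_def)
  qed
  moreover have "u \<in> M #> u"
    using u M_sub by (rule rcos_self)
  ultimately have "u \<in> rs ! i <# M"
    using rs[OF i] normal.coset_eq[OF M] by simp
  then obtain m where "m \<in> M" "u = rs ! i \<otimes> m"
    by (auto simp: l_coset_def)
  then have "reach (rs ! i) u"
    using rs[OF i] by (simp add: M_def)
  then show ?thesis
    by (simp add: reach_def)
qed

section \<open>Commutator identities\<close>

context group
begin

lemma commutator_closed [simp, intro]:
  "a \<in> carrier G \<Longrightarrow> b \<in> carrier G \<Longrightarrow> commutator G a b \<in> carrier G"
  by (simp add: commutator_def)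

lemma commutator_one [simp]: "a \<in> carrier G \<Longrightarrow> commutator G a \<one> = \<one>"
  by (simp add: commutator_def)

lemma commutator_eq_one_iff:
  assumes "a \<in> carrier G" "b \<in> carrier G"
  shows "commutator G a b = \<one> \<longleftrightarrow> a \<otimes> b = b \<otimes> a"
proof -
  have "commutator G a b = (a \<otimes> b) \<otimes> inv (b \<otimes> a)"
    using assms by (simp add: commutator_def inv_mult_group m_assoc)
  then show ?thesis
    using assms inv_solve_right'[of \<one> "a \<otimes> b" "b \<otimes> a"] by auto
qed

lemma commutator_inv_right_trivial:
  assumes "x \<in> carrier G" "y \<in> carrier G" "commutator G x y = \<one>"
  shows "commutator G x (inv y) = \<one>"
proof -
  have "commutator G x (inv y) = inv y \<otimes> inv (commutator G x y) \<otimes> y"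
    using assms(1,2) by (simp add: commutator_def inv_mult_group m_assoc)
  then show ?thesis using assms by simp
qed

text \<open>
  Conjugating by \<open>y\<close> turns \<open>[x,y\<inverse>]\<close> into \<open>[x,y]\<inverse> = d\<^sup>2\<close> and \<open>x\<close> into \<open>[x,y]\<inverse>x = d\<^sup>2x\<close>; these
  commute because \<open>d\<close> and \<open>x\<close> do.
\<close>

lemma double_commutator_trivial:
  assumes x: "x \<in> carrier G" and y: "y \<in> carrier G" and d: "d \<in> carrier G"
    and \<rho>: "d \<otimes> d \<otimes> commutator G x y = \<one>" and xd: "commutator G x d = \<one>"
  shows "commutator G x (commutator G x (inv y)) = \<one>"
proof -
  define p where "p = d \<otimes> d"
  have p: "p \<in> carrier G" using d by (simp add: p_def)
  have "x \<otimes> d = d \<otimes> x" using x d xd by (simp add: commutator_eq_one_iff)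
  then have xp: "x \<otimes> p = p \<otimes> x"
    using x d unfolding p_def by (metis m_assoc)
  have "p = inv (commutator G x y)"
    using \<rho> x y p inv_equality[of p "commutator G x y"] by (simp add: p_def inv_equality)
  then have p_eq: "p = y \<otimes> x \<otimes> inv y \<otimes> inv x"
    using x y by (simp add: commutator_def inv_mult_group m_assoc)
  have yx: "y \<otimes> x = p \<otimes> x \<otimes> y"
    using x y by (simp add: p_eq m_assoc)
  have xY: "x \<otimes> inv y = inv y \<otimes> p \<otimes> x"
    using x y by (simp add: p_eq m_assoc)
  have w: "commutator G x (inv y) = inv y \<otimes> p \<otimes> y"
    using x y by (simp add: p_eq commutator_def m_assoc)
  have "x \<otimes> (inv y \<otimes> p \<otimes> y) = (x \<otimes> inv y) \<otimes> p \<otimes> y"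
    using x y p by (simp add: m_assoc)
  also have "\<dots> = inv y \<otimes> p \<otimes> (x \<otimes> p) \<otimes> y"
    unfolding xY using x y p by (simp add: m_assoc)
  also have "\<dots> = inv y \<otimes> p \<otimes> (p \<otimes> x \<otimes> y)"
    unfolding xp using x y p by (simp add: m_assoc)
  also have "\<dots> = (inv y \<otimes> p \<otimes> y) \<otimes> x"
    unfolding yx[symmetric] using x y p by (simp add: m_assoc)
  finally show ?thesis
    using x y p by (simp add: w commutator_eq_one_iff)
qed

text \<open>
  Put \<open>e = [x,c\<inverse>]\<close>.  Then \<open>[c,x] = c e c\<inverse>\<close> and \<open>c\<inverse>xc = e\<inverse>x\<close>, so
  \<open>[x,[c,x]] = c [e\<inverse>x, e] c\<inverse> = (c e\<inverse>) [x,e] (c e\<inverse>)\<inverse>\<close>; the conjugator is \<open>c e\<inverse> = x c x\<inverse>\<close>.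
\<close>

lemma conj_commutator_double_commutator:
  assumes x: "x \<in> carrier G" and y: "y \<in> carrier G"
  defines "c \<equiv> commutator G (inv y) x"
  defines "w \<equiv> x \<otimes> c \<otimes> inv x"
  shows "w \<otimes> commutator G x (commutator G x (commutator G x (inv y))) \<otimes> inv w =
    commutator G x (commutator G c x)"
proof -
  have c: "c \<in> carrier G"
    using x y by (simp add: c_def)
  have "commutator G x (inv y) = inv c"
    using x y by (simp add: c_def commutator_def inv_mult_group m_assoc)
  then show ?thesis
    using x c by (simp add: w_def commutator_def inv_mult_group m_assoc)
qed

lemma conj_commutator_inv_left:
  assumes "x \<in> carrier G" "y \<in> carrier G"
  shows "y \<otimes> commutator G (inv y) x \<otimes> inv y = commutator G x y"
  using assms by (simp add: commutator_def m_assoc)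

end

lemma hom_commutator:
  assumes "group G" "group K" "h \<in> hom G K" "a \<in> carrier G" "b \<in> carrier G"
  shows "h (commutator G a b) = commutator K (h a) (h b)"
proof -
  interpret group_hom G K h
    using assms by (simp add: group_hom_def group_hom_axioms_def)
  show ?thesis using assms by (simp add: commutator_def)
qed

section \<open>The inclusion of free groups\<close>

lemma mult_free_group_Suc: "u \<otimes>\<^bsub>free_group (Suc n)\<^esub> v = u \<otimes>\<^bsub>free_group n\<^esub> v"
  by (simp add: free_group_def)

lemma one_free_group_Suc: "\<one>\<^bsub>free_group (Suc n)\<^esub> = \<one>\<^bsub>free_group n\<^esub>"
  by (simp add: free_group_def)

lemma inv_free_group_Suc:
  assumes u: "u \<in> carrier (free_group n)"
  shows "inv\<^bsub>free_group (Suc n)\<^esub> u = inv\<^bsub>free_group n\<^esub> u"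
proof -
  interpret F: group "free_group n" by (rule group_free_group)
  interpret F': group "free_group (Suc n)" by (rule group_free_group)
  show ?thesis
    using u F.l_inv[OF u] carrier_free_group_mono[of n]
    by (intro F'.inv_equality) (auto simp: mult_free_group_Suc one_free_group_Suc)
qed

lemma commutator_free_group_Suc:
  assumes "u \<in> carrier (free_group n)" "v \<in> carrier (free_group n)"
  shows "commutator (free_group (Suc n)) u v = commutator (free_group n) u v"
  using assms by (simp add: commutator_def mult_free_group_Suc inv_free_group_Suc)

section \<open>The equivalence\<close>

theorem mainTheorem5:
  shows "let F = free_group 2; x = gen 0; y = gen 1 in
    Qss_equivalent
      (2, [commutator F x y, \<one>\<^bsub>F\<^esub>])
      (2, [(commutator F x (commutator F x (inv\<^bsub>F\<^esub> y))) [^]\<^bsub>F\<^esub> (2::nat)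
             \<otimes>\<^bsub>F\<^esub> (y \<otimes>\<^bsub>F\<^esub> commutator F (inv\<^bsub>F\<^esub> y) x \<otimes>\<^bsub>F\<^esub> inv\<^bsub>F\<^esub> y),
           commutator F x (commutator F (commutator F (inv\<^bsub>F\<^esub> y) x) x)])"
proof -
  define F where "F = free_group 2"
  define H where "H = free_group 3"
  define x where "x = gen 0"
  define y where "y = gen 1"
  define t where "t = gen 2"
  interpret F: group F unfolding F_def by (rule group_free_group)
  interpret H: group H unfolding H_def by (rule group_free_group)
  have xyF: "x \<in> carrier F" "y \<in> carrier F"
    by (simp_all add: F_def x_def y_def gen_in_carrier)
  have xyt: "x \<in> carrier H" "y \<in> carrier H" "t \<in> carrier H"
    by (simp_all add: H_def x_def y_def t_def gen_in_carrier)
  note FH = mult_free_group_Suc[where n = 2, simplified, folded F_def H_def]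
    one_free_group_Suc[where n = 2, simplified, folded F_def H_def]
    inv_free_group_Suc[where n = 2, simplified, folded F_def H_def]
    commutator_free_group_Suc[where n = 2, simplified, folded F_def H_def]

  define \<rho> where "\<rho> = commutator H x y"
  define e where "e = commutator H x (commutator H x (inv\<^bsub>H\<^esub> y))"
  define d where "d = t \<otimes>\<^bsub>H\<^esub> e"
  define \<sigma> where "\<sigma> = d \<otimes>\<^bsub>H\<^esub> d \<otimes>\<^bsub>H\<^esub> \<rho>"
  define c where "c = commutator H (inv\<^bsub>H\<^esub> y) x"
  define r1 where "r1 = e \<otimes>\<^bsub>H\<^esub> e \<otimes>\<^bsub>H\<^esub> (y \<otimes>\<^bsub>H\<^esub> c \<otimes>\<^bsub>H\<^esub> inv\<^bsub>H\<^esub> y)"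
  define r2 where "r2 = commutator H x (commutator H c x)"
  have closed: "\<rho> \<in> carrier H" "e \<in> carrier H" "d \<in> carrier H" "\<sigma> \<in> carrier H" "c \<in> carrier H"
    "r1 \<in> carrier H" "r2 \<in> carrier H"
    using xyt by (simp_all add: \<rho>_def e_def d_def \<sigma>_def c_def r1_def r2_def)

  have hom_eqs: "h \<rho> = commutator K (h x) (h y)"
    "h e = commutator K (h x) (commutator K (h x) (inv\<^bsub>K\<^esub> (h y)))"
    "h d = h t \<otimes>\<^bsub>K\<^esub> h e" "h \<sigma> = h d \<otimes>\<^bsub>K\<^esub> h d \<otimes>\<^bsub>K\<^esub> h \<rho>"
    "h (commutator H x d) = commutator K (h x) (h d)" "h \<one>\<^bsub>H\<^esub> = \<one>\<^bsub>K\<^esub>"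
    "h x \<in> carrier K" "h y \<in> carrier K" "h t \<in> carrier K" "h d \<in> carrier K"
    if "group K" "h \<in> hom H K" for h and K :: "letter list set monoid"
  proof -
    interpret hom: group_hom H K h
      using that by (simp add: group_hom_def group_hom_axioms_def H.group_axioms)
    note hc = hom_commutator[OF H.group_axioms that]
    show "h \<rho> = commutator K (h x) (h y)"
      "h e = commutator K (h x) (commutator K (h x) (inv\<^bsub>K\<^esub> (h y)))"
      "h d = h t \<otimes>\<^bsub>K\<^esub> h e" "h \<sigma> = h d \<otimes>\<^bsub>K\<^esub> h d \<otimes>\<^bsub>K\<^esub> h \<rho>"
      "h (commutator H x d) = commutator K (h x) (h d)" "h \<one>\<^bsub>H\<^esub> = \<one>\<^bsub>K\<^esub>"
      "h x \<in> carrier K" "h y \<in> carrier K" "h t \<in> carrier K" "h d \<in> carrier K"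
      using xyt closed by (simp_all add: \<rho>_def e_def d_def \<sigma>_def hc)
  qed
  have pres: "is_presentation (3, [a, b, k])"
    if "a \<in> carrier H" "b \<in> carrier H" "k \<in> carrier H" for a b k
    using that by (simp add: is_presentation_def H_def)
  note replace = replace_relator[where n = 3, folded H_def, OF pres]

  have pres2: "is_presentation (2, [\<rho>, \<one>\<^bsub>H\<^esub>])" "is_presentation (2, [r1, r2])"
    using xyF by (simp_all add: is_presentation_def F_def[symmetric] \<rho>_def r1_def r2_def e_def c_def FH)

  have "Qss_step (2, [\<rho>, \<one>\<^bsub>H\<^esub>]) (3, [\<rho>, \<one>\<^bsub>H\<^esub>, t])"
    using stabilize[of 2 "[\<rho>, \<one>\<^bsub>H\<^esub>]"] by (simp add: t_def)
  also have "Qss_step\<^sup>*\<^sup>* (3, [\<rho>, \<one>\<^bsub>H\<^esub>, t]) (3, [\<rho>, \<one>\<^bsub>H\<^esub>, t][2 := d])"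
  proof (rule replace)
    fix K :: "letter list set monoid" and h
    assume K: "group K" "h \<in> hom H K"
      and kill: "\<And>j. j < length [\<rho>, \<one>\<^bsub>H\<^esub>, t] \<Longrightarrow> j \<noteq> 2 \<Longrightarrow> h ([\<rho>, \<one>\<^bsub>H\<^esub>, t] ! j) = \<one>\<^bsub>K\<^esub>"
    interpret K: group K by (rule K)
    have "h e = \<one>\<^bsub>K\<^esub>"
      using kill[of 0] by (simp add: hom_eqs[OF K] K.commutator_inv_right_trivial)
    then show "h ([\<rho>, \<one>\<^bsub>H\<^esub>, t] ! 2) = h d"
      using hom_eqs(3,9)[OF K] by simp
  qed (use xyt closed in simp_all)
  also have "[\<rho>, \<one>\<^bsub>H\<^esub>, t][2 := d] = [\<rho>, \<one>\<^bsub>H\<^esub>, d]"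
    by simp
  also have "Qss_step\<^sup>*\<^sup>* (3, [\<rho>, \<one>\<^bsub>H\<^esub>, d]) (3, [\<rho>, \<one>\<^bsub>H\<^esub>, d][1 := commutator H x d])"
  proof (rule replace)
    fix K :: "letter list set monoid" and h
    assume K: "group K" "h \<in> hom H K"
      and kill: "\<And>j. j < length [\<rho>, \<one>\<^bsub>H\<^esub>, d] \<Longrightarrow> j \<noteq> 1 \<Longrightarrow> h ([\<rho>, \<one>\<^bsub>H\<^esub>, d] ! j) = \<one>\<^bsub>K\<^esub>"
    interpret K: group K by (rule K)
    show "h ([\<rho>, \<one>\<^bsub>H\<^esub>, d] ! 1) = h (commutator H x d)"
      using kill[of 2] hom_eqs(5-7)[OF K] by simp
  qed (use xyt closed in simp_all)
  also have "[\<rho>, \<one>\<^bsub>H\<^esub>, d][1 := commutator H x d] = [\<rho>, commutator H x d, d]"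
    by simp
  also have "Qss_step\<^sup>*\<^sup>* (3, [\<rho>, commutator H x d, d]) (3, [\<rho>, commutator H x d, d][0 := \<sigma>])"
  proof (rule replace)
    fix K :: "letter list set monoid" and h
    assume K: "group K" "h \<in> hom H K"
      and kill: "\<And>j. j < length [\<rho>, commutator H x d, d] \<Longrightarrow> j \<noteq> 0 \<Longrightarrow>
        h ([\<rho>, commutator H x d, d] ! j) = \<one>\<^bsub>K\<^esub>"
    interpret K: group K by (rule K)
    show "h ([\<rho>, commutator H x d, d] ! 0) = h \<sigma>"
      using kill[of 2] hom_eqs(1,4,7,8)[OF K] by simp
  qed (use xyt closed in simp_all)
  also have "[\<rho>, commutator H x d, d][0 := \<sigma>] = [\<sigma>, commutator H x d, d]"
    by simp
  also have "Qss_step\<^sup>*\<^sup>* (3, [\<sigma>, commutator H x d, d]) (3, [\<sigma>, commutator H x d, d][2 := t])"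
  proof (rule replace)
    fix K :: "letter list set monoid" and h
    assume K: "group K" "h \<in> hom H K"
      and kill: "\<And>j. j < length [\<sigma>, commutator H x d, d] \<Longrightarrow> j \<noteq> 2 \<Longrightarrow>
        h ([\<sigma>, commutator H x d, d] ! j) = \<one>\<^bsub>K\<^esub>"
    interpret K: group K by (rule K)
    have "h d \<otimes>\<^bsub>K\<^esub> h d \<otimes>\<^bsub>K\<^esub> commutator K (h x) (h y) = \<one>\<^bsub>K\<^esub>" "commutator K (h x) (h d) = \<one>\<^bsub>K\<^esub>"
      using kill[of 0] kill[of 1] hom_eqs(1,4,5)[OF K] by simp_all
    then have "h e = \<one>\<^bsub>K\<^esub>"
      using K.double_commutator_trivial hom_eqs[OF K] by metis
    then show "h ([\<sigma>, commutator H x d, d] ! 2) = h t"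
      using hom_eqs(3,9)[OF K] by simp
  qed (use xyt closed in simp_all)
  also have "[\<sigma>, commutator H x d, d][2 := t] = [\<sigma>, commutator H x d, t]"
    by simp
  also have "Qss_step\<^sup>*\<^sup>* (3, [\<sigma>, commutator H x d, t])
    (3, [\<sigma>, commutator H x d, t][1 := commutator H x e])"
  proof (rule replace)
    fix K :: "letter list set monoid" and h
    assume K: "group K" "h \<in> hom H K"
      and kill: "\<And>j. j < length [\<sigma>, commutator H x d, t] \<Longrightarrow> j \<noteq> 1 \<Longrightarrow>
        h ([\<sigma>, commutator H x d, t] ! j) = \<one>\<^bsub>K\<^esub>"
    interpret K: group K by (rule K)
    have "h d = h e"
      using kill[of 2] hom_eqs[OF K] by simp
    then show "h ([\<sigma>, commutator H x d, t] ! 1) = h (commutator H x e)"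
      using hom_commutator[OF H.group_axioms K] xyt closed by simp
  qed (use xyt closed in simp_all)
  also have "[\<sigma>, commutator H x d, t][1 := commutator H x e] = [\<sigma>, commutator H x e, t]"
    by simp
  also have "Qss_step (3, [\<sigma>, commutator H x e, t]) (3, [\<sigma>, r2, t])"
    using conjugate[of 1 "[\<sigma>, commutator H x e, t]" "x \<otimes>\<^bsub>H\<^esub> c \<otimes>\<^bsub>H\<^esub> inv\<^bsub>H\<^esub> x" 3] xyt closed
      H.conj_commutator_double_commutator[of x y]
    by (simp add: H_def[symmetric] r2_def c_def e_def)
  also have "Qss_step\<^sup>*\<^sup>* (3, [\<sigma>, r2, t]) (3, [\<sigma>, r2, t][0 := r1])"
  proof (rule replace)
    fix K :: "letter list set monoid" and h
    assume K: "group K" "h \<in> hom H K"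
      and kill: "\<And>j. j < length [\<sigma>, r2, t] \<Longrightarrow> j \<noteq> 0 \<Longrightarrow> h ([\<sigma>, r2, t] ! j) = \<one>\<^bsub>K\<^esub>"
    interpret K: group K by (rule K)
    have "h d = h e"
      using kill[of 2] hom_eqs[OF K] by simp
    moreover have "r1 = e \<otimes>\<^bsub>H\<^esub> e \<otimes>\<^bsub>H\<^esub> \<rho>"
      using xyt by (simp add: r1_def c_def \<rho>_def H.conj_commutator_inv_left)
    ultimately show "h ([\<sigma>, r2, t] ! 0) = h r1"
      using hom_eqs(4)[OF K] K(2) closed by (simp add: hom_mult)
  qed (use xyt closed in simp_all)
  also have "[\<sigma>, r2, t][0 := r1] = [r1, r2, t]"
    by simp
  also have "Qss_step (3, [r1, r2, t]) (2, [r1, r2])"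
    using destabilize[OF pres2(2)] by (simp add: t_def)
  finally have "Qss_equivalent (2, [\<rho>, \<one>\<^bsub>H\<^esub>]) (2, [r1, r2])"
    using pres2 by (simp add: Qss_equivalent_def)
  then show ?thesis
    using xyF unfolding Let_def F_def[symmetric] x_def[symmetric] y_def[symmetric]
    by (simp add: \<rho>_def r1_def r2_def e_def c_def FH numeral_2_eq_2)
qed

end
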